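(* Let $X$ be a non-empty compact metrizable space, $T : X \to X$ a continuous map, and $\mathcal{C} \subset C(X)$. Let $H$ be the smallest linear subspace of $C(X)$ containing $\mathcal{C}$. Then for any $\phi \in C(X)$, $$\sup_{\mu \in M_{\mathcal{C}}(X,T)} \int \phi \, d\mu = \inf\{ c \in \mathbb{R} : \text{there exist } f \in H,\ g \in C(X) \text{ with } f + g - g \circ T + c \geq \phi \}.$$
   Context: $C(X)$ is the space of continuous functions $X \to \mathbb{R}$; the inequality is pointwise on $X$. $M(X,T)$ is the set of $T$-invariant Borel probability measures on $X$, and $M_{\mathcal{C}}(X,T) = \{\mu \in M(X,T) : \int g \, d\mu = 0 \text{ for all } g \in \mathcal{C}\}$. The feasible set $M_{\mathcal{C}}(X,T)$ may be empty; the convention is $\sup \varnothing = -\infty$ (and $\inf \varnothing = +\infty$), and the equality is in $[-\infty,+\infty]$. *)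

theory Defs
  imports "HOL-Probability.Probability"
begin

definition invariant_prob_measures :: "('a::topological_space \<Rightarrow> 'a) \<Rightarrow> 'a measure set"
  where "invariant_prob_measures T =
    {\<mu>. sets \<mu> = sets borel \<and> prob_space \<mu> \<and> distr \<mu> borel T = \<mu>}"

(* For compact 'a, the type 'a \<Rightarrow>\<^sub>C real of bounded continuous functions is all of C(X). *)
definition constrained_invariant_measures ::
    "('a::topological_space \<Rightarrow> 'a) \<Rightarrow> ('a \<Rightarrow>\<^sub>C real) set \<Rightarrow> 'a measure set"
  where "constrained_invariant_measures T \<C> =
    {\<mu> \<in> invariant_prob_measures T. \<forall>g\<in>\<C>. (\<integral>x. apply_bcontfun g x \<partial>\<mu>) = 0}"

end

theory Submission
  imports Defs
begin

text \<open>
  The statement is linear programming duality. A \<open>T\<close>-invariant probability measure that integrates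
  \<open>\<C>\<close> to zero is the same as a probability measure that integrates to zero every function in the
  linear space \<open>W = {f + (g - g \<circ> T) | f g. f \<in> H}\<close>: vanishing on all coboundaries \<open>g - g \<circ> T\<close> says
  that a measure and its image under \<open>T\<close> have the same integrals of continuous functions, and
  these integrals determine a Borel measure (\<open>invariant_iff_coboundaries\<close>). So it
  suffices to prove, for an arbitrary linear subspace \<open>W\<close>, that the supremum of the integrals of
  \<open>\<phi>\<close> over the probability measures annihilating \<open>W\<close> is the infimum of all \<open>c\<close> with
  \<open>\<phi> \<le> w + c\<close> for some \<open>w \<in> W\<close> (\<open>probability_duality\<close>).

  Integrating \<open>\<phi> \<le> w + c\<close> shows that the supremum is at most the infimum. For the converse, consider
  the infimum \<open>p \<phi>\<close> as a function of \<open>\<phi>\<close>. If \<open>W\<close> contains a function that is at least \<open>1\<close>, then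
  \<open>p\<close> is identically \<open>-\<infinity>\<close> and nothing remains to be shown. Otherwise \<open>p\<close> is a finite sublinear
  functional, and by the Hahn-Banach theorem there is a linear \<open>L \<le> p\<close> with \<open>L \<phi> = p \<phi>\<close>. From
  \<open>L \<le> p\<close> one reads off that \<open>L\<close> is positive, that \<open>L 1 = 1\<close> and that \<open>L\<close> vanishes on \<open>W\<close>. The
  Riesz representation theorem turns \<open>L\<close> into a probability measure, which attains the supremum.

  The Hahn-Banach theorem (\<open>Hahn_Banach_sublinear\<close>) is obtained from Zorn's lemma: a minimal
  sublinear functional is linear. The Riesz theorem (\<open>Riesz_representation\<close>) is proved by extending
  \<open>L\<close> to a countably subadditive outer integral. Its restriction to indicators is an outer measure
  for which every cozero set, hence in a metrizable space every open set, is Caratheodory measurable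
  (\<open>cozero_in_lambda_system\<close>). Compactness gives total mass \<open>1\<close> (\<open>\<nu>_UNIV\<close>), and cutting a function
  into thin horizontal slices shows that the resulting measure represents \<open>L\<close>
  (\<open>integral_representing\<close>).
\<close>

section \<open>The Hahn-Banach theorem for sublinear functionals\<close>

definition sublinear :: "('v::real_vector \<Rightarrow> real) \<Rightarrow> bool"
  where "sublinear p \<longleftrightarrow>
    (\<forall>x y. p (x + y) \<le> p x + p y) \<and> (\<forall>x. \<forall>c>0. p (c *\<^sub>R x) \<le> c * p x)"

lemma sublinear_add: "sublinear p \<Longrightarrow> p (x + y) \<le> p x + p y"
  by (simp add: sublinear_def)

lemma sublinear_scale:
  assumes "sublinear p" "0 < c"
  shows "p (c *\<^sub>R x) = c * p x"
proof (rule antisym)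
  show "p (c *\<^sub>R x) \<le> c * p x"
    using assms by (simp add: sublinear_def)
  have "p (inverse c *\<^sub>R (c *\<^sub>R x)) \<le> inverse c * p (c *\<^sub>R x)"
    using assms unfolding sublinear_def by (meson positive_imp_inverse_positive)
  then show "c * p x \<le> p (c *\<^sub>R x)"
    using assms(2) by (simp add: field_simps)
qed

lemma sublinear_zero: "sublinear p \<Longrightarrow> p 0 = 0"
  using sublinear_scale[of p 2 0] by simp

lemma sublinear_minus: "sublinear p \<Longrightarrow> - p (- x) \<le> p x"
  using sublinear_add[of p x "- x"] sublinear_zero[of p] by simp

text \<open>For a linear functional the expression under the infimum is \<open>p x\<close> for every \<open>t\<close>. For a
  sublinear one, the infimum is the largest sublinear functional below \<open>p\<close> whose value at \<open>- y\<close> is at most \<open>- p y\<close>: it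
  makes \<open>p\<close> linear along the line through \<open>y\<close>.\<close>

definition tilt :: "('v::real_vector \<Rightarrow> real) \<Rightarrow> 'v \<Rightarrow> 'v \<Rightarrow> real"
  where "tilt p y x = (INF t\<in>{0..}. p (x + t *\<^sub>R y) - t * p y)"

lemma tilt_lower_bound:
  assumes "sublinear p" "0 \<le> t"
  shows "- p (- x) \<le> p (x + t *\<^sub>R y) - t * p y"
proof -
  have "t * p y = p (t *\<^sub>R y)"
    using assms sublinear_scale[of p t y] sublinear_zero[of p] by (cases "t = 0") auto
  also have "\<dots> \<le> p (x + t *\<^sub>R y) + p (- x)"
    using sublinear_add[OF assms(1), of "x + t *\<^sub>R y" "- x"] by simp
  finally show ?thesis by simp
qed

lemma tilt_le:
  assumes "sublinear p" "0 \<le> t"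
  shows "tilt p y x \<le> p (x + t *\<^sub>R y) - t * p y"
  unfolding tilt_def
  by (rule cINF_lower) (use assms tilt_lower_bound in \<open>auto intro!: bdd_belowI\<close>)

lemma tilt_le_self: "sublinear p \<Longrightarrow> tilt p y x \<le> p x"
  using tilt_le[of p 0 y x] by simp

lemma sublinear_tilt:
  assumes p: "sublinear p"
  shows "sublinear (tilt p y)"
  unfolding sublinear_def
proof (intro conjI allI impI)
  fix x x'
  have *: "tilt p y (x + x') \<le> (p (x + s *\<^sub>R y) - s * p y) + (p (x' + t *\<^sub>R y) - t * p y)"
    if "0 \<le> s" "0 \<le> t" for s t
    using tilt_le[OF p, of "s + t" y "x + x'"] that
      sublinear_add[OF p, of "x + s *\<^sub>R y" "x' + t *\<^sub>R y"]
    by (simp add: algebra_simps)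
  have "tilt p y (x + x') - (p (x' + t *\<^sub>R y) - t * p y) \<le> tilt p y x" if "0 \<le> t" for t
    unfolding tilt_def[of p y x]
    by (rule cINF_greatest) (use *[OF _ that] in \<open>auto simp: algebra_simps\<close>)
  then have "tilt p y (x + x') - tilt p y x \<le> tilt p y x'"
    unfolding tilt_def[of p y x'] by (intro cINF_greatest) (auto simp: algebra_simps)
  then show "tilt p y (x + x') \<le> tilt p y x + tilt p y x'" by simp
next
  fix x and c :: real assume c: "0 < c"
  have "tilt p y (c *\<^sub>R x) / c \<le> tilt p y x"
    unfolding tilt_def[of p y x]
  proof (rule cINF_greatest)
    fix t :: real assume "t \<in> {0..}"
    then have "tilt p y (c *\<^sub>R x) \<le> p (c *\<^sub>R (x + t *\<^sub>R y)) - c * t * p y"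
      using tilt_le[OF p, of "c * t" y "c *\<^sub>R x"] c by (simp add: algebra_simps)
    also have "\<dots> = c * (p (x + t *\<^sub>R y) - t * p y)"
      unfolding sublinear_scale[OF p c] by (simp add: right_diff_distrib)
    finally show "tilt p y (c *\<^sub>R x) / c \<le> p (x + t *\<^sub>R y) - t * p y"
      using c by (simp add: field_simps)
  qed simp
  then show "tilt p y (c *\<^sub>R x) \<le> c * tilt p y x"
    using c by (simp add: field_simps)
qed

text \<open>In the subadditivity of the infimum the two summands may be nearly minimized by different
  functionals; in a chain, the smaller of the two serves for both. The upper bound \<open>p\<close> is what
  keeps the infimum finite, since \<open>- p (- x) \<le> q x\<close> for every sublinear \<open>q \<le> p\<close>.\<close>

lemma sublinear_chain_Inf:
  fixes C :: "('v::real_vector \<Rightarrow> real) set"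
  assumes ne: "C \<noteq> {}"
    and sub: "\<And>q. q \<in> C \<Longrightarrow> sublinear q"
    and le: "\<And>q. q \<in> C \<Longrightarrow> q \<le> p"
    and chain: "\<And>q r. q \<in> C \<Longrightarrow> r \<in> C \<Longrightarrow> q \<le> r \<or> r \<le> q"
  shows "sublinear (\<lambda>x. INF q\<in>C. q x)" and "\<And>q x. q \<in> C \<Longrightarrow> (INF q\<in>C. q x) \<le> q x"
proof -
  have "- p (- x) \<le> q x" if "q \<in> C" for q x
    using sublinear_minus[OF sub[OF that], of x] le[OF that] le_funD[of q p "- x"] by linarith
  then have bdd: "bdd_below ((\<lambda>q. q x) ` C)" for x
    by (auto intro!: bdd_belowI)
  show lower: "(INF q\<in>C. q x) \<le> q x" if "q \<in> C" for q x
    by (rule cINF_lower[OF bdd that])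
  show "sublinear (\<lambda>x. INF q\<in>C. q x)"
    unfolding sublinear_def
  proof (intro conjI allI impI)
    fix x y :: 'v
    have *: "(INF q\<in>C. q (x + y)) \<le> q x + r y" if q: "q \<in> C" and r: "r \<in> C" for q r
    proof -
      \<comment> \<open>The smaller of two comparable functionals bounds both summands.\<close>
      obtain s where s: "s \<in> C" "s x \<le> q x" "s y \<le> r y"
        using chain[OF q r] q r by (auto simp: le_fun_def)
      then show ?thesis
        using lower[OF s(1), of "x + y"] sublinear_add[OF sub[OF s(1)], of x y] by linarith
    qed
    have "(INF q\<in>C. q (x + y)) - r y \<le> (INF q\<in>C. q x)" if "r \<in> C" for r
      by (rule cINF_greatest[OF ne]) (use *[OF _ that] in \<open>auto simp: algebra_simps\<close>)
    then have "(INF q\<in>C. q (x + y)) - (INF q\<in>C. q x) \<le> (INF q\<in>C. q y)"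
      by (intro cINF_greatest[OF ne]) (auto simp: algebra_simps)
    then show "(INF q\<in>C. q (x + y)) \<le> (INF q\<in>C. q x) + (INF q\<in>C. q y)" by simp
  next
    fix x :: 'v and c :: real assume c: "0 < c"
    have "(INF q\<in>C. q (c *\<^sub>R x)) / c \<le> (INF q\<in>C. q x)"
    proof (rule cINF_greatest[OF ne])
      fix q assume "q \<in> C"
      then show "(INF q\<in>C. q (c *\<^sub>R x)) / c \<le> q x"
        using lower[of q "c *\<^sub>R x"] sublinear_scale[OF sub c, of q x] c by (simp add: field_simps)
    qed
    then show "(INF q\<in>C. q (c *\<^sub>R x)) \<le> c * (INF q\<in>C. q x)"
      using c by (simp add: field_simps)
  qed
qed

lemma minimal_sublinear_exists:
  fixes p :: "'v::real_vector \<Rightarrow> real"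
  assumes p: "sublinear p"
  obtains q where "sublinear q" "q \<le> p" "\<And>r. sublinear r \<Longrightarrow> r \<le> q \<Longrightarrow> r = q"
proof -
  let ?A = "{q. sublinear q \<and> q \<le> p}"
  have "\<exists>m\<in>?A. \<forall>a\<in>?A. m \<ge> a \<longrightarrow> a = m"
  proof (rule predicate_Zorn)
    show "partial_order_on ?A (relation_of (\<ge>) ?A)"
      by (auto simp: partial_order_on_def preorder_on_def refl_on_def trans_def antisym_def
          relation_of_def)
  next
    fix C assume C: "C \<in> Chains (relation_of (\<ge>) ?A)"
    have mem: "sublinear q" "q \<le> p" if "q \<in> C" for q
      using C that by (auto simp: Chains_def relation_of_def)
    have chain: "q \<le> r \<or> r \<le> q" if "q \<in> C" "r \<in> C" for q r
      using C that by (auto simp: Chains_def relation_of_def)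
    show "\<exists>u\<in>?A. \<forall>a\<in>C. a \<ge> u"
    proof (cases "C = {}")
      case True
      then show ?thesis using p by auto
    next
      case False
      have sub: "sublinear (\<lambda>x. INF q\<in>C. q x)"
        by (rule sublinear_chain_Inf(1)[OF False, of p]) (use mem chain in auto)
      have lower: "(INF q\<in>C. q x) \<le> q x" if "q \<in> C" for q x
        by (rule sublinear_chain_Inf(2)[OF False, of p]) (use mem chain that in auto)
      obtain q where "q \<in> C" using False by auto
      then have "(\<lambda>x. INF q\<in>C. q x) \<le> p"
        using lower[OF \<open>q \<in> C\<close>] mem(2)[OF \<open>q \<in> C\<close>] by (auto simp: le_fun_def intro: order_trans)
      then show ?thesis
        using sub lower by (intro bexI[of _ "\<lambda>x. INF q\<in>C. q x"]) (auto simp: le_fun_def)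
    qed
  qed
  then show thesis using that by (blast intro: order_trans)
qed

text \<open>Minimality gives \<open>tilt q y = q\<close> for every \<open>y\<close>, and the bound at \<open>t = 1\<close> then reads
  \<open>q x + q y \<le> q (x + y)\<close>, the reverse of subadditivity.\<close>

lemma minimal_sublinear_linear:
  fixes q :: "'v::real_vector \<Rightarrow> real"
  assumes q: "sublinear q" and min: "\<And>r. sublinear r \<Longrightarrow> r \<le> q \<Longrightarrow> r = q"
  shows "linear q"
proof -
  have tilt: "tilt q y = q" for y
    using min[OF sublinear_tilt[OF q]] tilt_le_self[OF q] by (simp add: le_fun_def)
  have add: "q (x + y) = q x + q y" for x y
    using tilt_le[OF q, of 1 y x] sublinear_add[OF q, of x y] tilt[of y] by simp
  have neg: "q (- x) = - q x" for x
    using add[of x "- x"] sublinear_zero[OF q] by simp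
  have "q (c *\<^sub>R x) = c * q x" for c x
  proof (cases "c > 0")
    case False
    show ?thesis
    proof (cases "c = 0")
      case False
      then show ?thesis
        using sublinear_scale[OF q, of "- c" x] \<open>\<not> c > 0\<close> neg[of "c *\<^sub>R x"] by simp
    qed (use sublinear_zero[OF q] in simp)
  qed (use sublinear_scale[OF q] in simp)
  then show ?thesis by (intro linearI) (auto simp: add)
qed

text \<open>Taking the minimal functional below \<open>tilt p y\<close>, and not merely below \<open>p\<close>, forces equality at
  \<open>y\<close>: it gives \<open>L (- y) \<le> - p y\<close>, that is \<open>p y \<le> L y\<close>.\<close>

theorem Hahn_Banach_sublinear:
  fixes p :: "'v::real_vector \<Rightarrow> real"
  assumes p: "sublinear p"
  obtains L where "linear L" "\<And>x. L x \<le> p x" "L y = p y"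
proof -
  obtain L where L: "sublinear L" "L \<le> tilt p y" "\<And>r. sublinear r \<Longrightarrow> r \<le> L \<Longrightarrow> r = L"
    using minimal_sublinear_exists[OF sublinear_tilt[OF p]] by blast
  have lin: "linear L" by (rule minimal_sublinear_linear[OF L(1,3)])
  have le: "L x \<le> p x" for x
    using L(2) tilt_le_self[OF p, of y x] by (auto simp: le_fun_def intro: order_trans)
  have "L (- y) \<le> tilt p y (- y)" using L(2) by (simp add: le_fun_def)
  also have "\<dots> \<le> - p y"
    using tilt_le[OF p, of 1 y "- y"] sublinear_zero[OF p] by simp
  finally have "p y \<le> L y" using linear_neg[OF lin, of y] by simp
  with le[of y] have "L y = p y" by simp
  with lin le show thesis by (rule that)
qed

section \<open>Open sets of metrizable spaces as cozero sets\<close>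

text \<open>The function is the distance to the complement, which is 1-Lipschitz. The whole space has empty
  complement and is treated separately.\<close>

lemma metrizable_open_eq_cozero:
  fixes U :: "'a::topological_space set"
  assumes metr: "metrizable_space (euclidean :: 'a topology)" and U: "open U"
  obtains h :: "'a \<Rightarrow> real"
  where "continuous_on UNIV h" "\<And>x. 0 \<le> h x" "U = {x. 0 < h x}"
proof (cases "U = UNIV")
  case True
  then show ?thesis using that[of "\<lambda>_. 1"] by simp
next
  case False
  obtain M :: "'a set" and d where "Metric_space M d" and top: "euclidean = Metric_space.mtopology M d"
    using metr unfolding metrizable_space_def by blast
  then interpret Metric_space M d by simp
  have M: "M = (UNIV :: 'a set)" using topspace_mtopology by (simp flip: top)
  have open_iff: "open V \<longleftrightarrow> (\<forall>x\<in>V. \<exists>r>0. mball x r \<subseteq> V)" for V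
  proof -
    have "openin euclidean V \<longleftrightarrow> V \<subseteq> M \<and> (\<forall>x. x \<in> V \<longrightarrow> (\<exists>r>0. mball x r \<subseteq> V))"
      unfolding top by (rule openin_mtopology)
    then show ?thesis by (auto simp: M)
  qed
  define h where "h x = (INF u\<in>- U. d x u)" for x
  have bdd: "bdd_below (d x ` (- U))" for x by (auto intro!: bdd_belowI[of _ 0])
  have ne: "- U \<noteq> {}" using False by auto
  have lip: "h x \<le> d x y + h y" for x y
  proof -
    have "h x - d x y \<le> h y"
      unfolding h_def[of y]
    proof (rule cINF_greatest[OF ne])
      fix u assume "u \<in> - U"
      then have "h x \<le> d x u" unfolding h_def by (rule cINF_lower[OF bdd])
      then show "h x - d x y \<le> d y u" using triangle[of x y u] by (simp add: M)
    qed
    then show ?thesis by simp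
  qed
  have nonneg: "0 \<le> h x" for x unfolding h_def by (rule cINF_greatest[OF ne]) simp
  have "continuous_on UNIV h"
  proof (subst continuous_on_open_vimage[OF open_UNIV], intro allI impI)
    fix B :: "real set" assume B: "open B"
    show "open (h -` B \<inter> UNIV)"
      unfolding open_iff
    proof
      fix x assume "x \<in> h -` B \<inter> UNIV"
      then obtain r where r: "r > 0" "ball (h x) r \<subseteq> B" using B by (auto elim: openE)
      have "h y \<in> B" if "d x y < r" for y
        using lip[of x y] lip[of y x] that r(2) commute[of x y]
        by (auto simp: dist_real_def abs_less_iff subset_iff)
      then show "\<exists>r>0. mball x r \<subseteq> h -` B \<inter> UNIV" using r(1) by (auto intro!: exI[of _ r])
    qed
  qed
  moreover have "U = {x. 0 < h x}"
  proof (intro set_eqI iffI; simp)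
    fix x assume "x \<in> U"
    then obtain r where r: "r > 0" "mball x r \<subseteq> U" using U open_iff by blast
    have "r \<le> h x"
      unfolding h_def
    proof (rule cINF_greatest[OF ne])
      fix u assume "u \<in> - U"
      then have "u \<notin> mball x r" using r(2) by blast
      then show "r \<le> d x u" unfolding in_mball by (simp add: M)
    qed
    then show "0 < h x" using r by simp
  next
    fix x assume pos: "0 < h x"
    show "x \<in> U"
    proof (rule ccontr)
      assume "x \<notin> U"
      then have "h x \<le> d x x" unfolding h_def by (intro cINF_lower[OF bdd]) simp
      then show False using pos by (simp add: M)
    qed
  qed
  ultimately show ?thesis using that nonneg by blast
qed

text \<open>For \<open>h \<ge> 0\<close> the ramps increase pointwise to the indicator of \<open>{x. 0 < h x}\<close>, so they let
  countable operations on continuous functions reach every cozero set.\<close>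

definition ramp :: "('a \<Rightarrow> real) \<Rightarrow> nat \<Rightarrow> 'a \<Rightarrow> real"
  where "ramp h k x = min 1 (real k * h x)"

lemma ramp_0: "ramp h 0 x = 0"
  by (simp add: ramp_def)

lemma continuous_on_ramp: "continuous_on S h \<Longrightarrow> continuous_on S (ramp h k)"
  unfolding ramp_def by (intro continuous_intros)

lemma ramp_bounds:
  assumes "0 \<le> h x"
  shows "0 \<le> ramp h k x" and "ramp h k x \<le> 1" and "ramp h k x \<le> ramp h (Suc k) x"
  using assms by (auto simp: ramp_def min_def distrib_right)

lemma SUP_ramp:
  fixes h :: "'a \<Rightarrow> real"
  assumes "0 \<le> h x"
  shows "(SUP k. ennreal (ramp h k x)) = indicator {x. 0 < h x} x"
proof (cases "0 < h x")
  case True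
  obtain k :: nat where "1 / h x < real k" using reals_Archimedean2 by blast
  then have "ramp h k x = 1" using True by (simp add: ramp_def field_simps min_def)
  then have "1 \<le> (SUP k. ennreal (ramp h k x))"
    by (intro SUP_upper2[of k]) auto
  moreover have "(SUP k. ennreal (ramp h k x)) \<le> 1"
    using ramp_bounds[of h x] assms by (intro SUP_least) simp
  ultimately show ?thesis using True by simp
qed (use assms in \<open>simp add: ramp_def\<close>)

section \<open>The outer integral of a positive functional\<close>

locale positive_functional =
  fixes \<Lambda> :: "('a::topological_space \<Rightarrow> real) \<Rightarrow> real"
  assumes add: "\<And>f g. continuous_on UNIV f \<Longrightarrow> continuous_on UNIV g \<Longrightarrow>
      \<Lambda> (\<lambda>x. f x + g x) = \<Lambda> f + \<Lambda> g"
    and scale: "\<And>c f. continuous_on UNIV f \<Longrightarrow> \<Lambda> (\<lambda>x. c * f x) = c * \<Lambda> f"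
    and nonneg: "\<And>f. continuous_on UNIV f \<Longrightarrow> (\<And>x. 0 \<le> f x) \<Longrightarrow> 0 \<le> \<Lambda> f"
begin

lemma diff:
  assumes "continuous_on UNIV f" "continuous_on UNIV g"
  shows "\<Lambda> (\<lambda>x. f x - g x) = \<Lambda> f - \<Lambda> g"
  using add[OF assms(1), of "\<lambda>x. (- 1) * g x"] scale[OF assms(2), of "- 1"] assms
  by (simp add: continuous_intros)

lemma mono:
  assumes "continuous_on UNIV f" "continuous_on UNIV g" "\<And>x. f x \<le> g x"
  shows "\<Lambda> f \<le> \<Lambda> g"
  using nonneg[of "\<lambda>x. g x - f x"] diff[OF assms(2,1)] assms by (simp add: continuous_intros)

lemma zero: "\<Lambda> (\<lambda>x. 0) = 0"
  using scale[of "\<lambda>x. 0" 0] by simp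

lemma sum:
  assumes "finite I" "\<And>i. i \<in> I \<Longrightarrow> continuous_on UNIV (f i)"
  shows "\<Lambda> (\<lambda>x. \<Sum>i\<in>I. f i x) = (\<Sum>i\<in>I. \<Lambda> (f i))"
  using assms by (induction rule: finite_induct) (simp_all add: zero add continuous_intros)

text \<open>
  Extending the functional to arbitrary nonnegative functions through countable sums of
  continuous majorants builds countable subadditivity into the definition. The induced outer
  measure of a set is the outer integral of its indicator. Working with functions instead of sets
  lets the measurability proof treat each majorant on its own.
\<close>

definition majorants :: "('a \<Rightarrow> ennreal) \<Rightarrow> (nat \<Rightarrow> 'a \<Rightarrow> real) set"
  where "majorants \<phi> = {f. (\<forall>n. continuous_on UNIV (f n)) \<and> (\<forall>n x. 0 \<le> f n x) \<and>
    (\<forall>x. \<phi> x \<le> (\<Sum>n. ennreal (f n x)))}"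

definition outer_integral :: "('a \<Rightarrow> ennreal) \<Rightarrow> ennreal"
  where "outer_integral \<phi> = (INF f\<in>majorants \<phi>. \<Sum>n. ennreal (\<Lambda> (f n)))"

lemma majorantsD:
  assumes "f \<in> majorants \<phi>"
  shows "continuous_on UNIV (f n)" "0 \<le> f n x" "\<phi> x \<le> (\<Sum>n. ennreal (f n x))" "0 \<le> \<Lambda> (f n)"
  using assms nonneg by (auto simp: majorants_def)

lemma outer_integral_le: "f \<in> majorants \<phi> \<Longrightarrow> outer_integral \<phi> \<le> (\<Sum>n. ennreal (\<Lambda> (f n)))"
  unfolding outer_integral_def by (rule INF_lower)

lemma outer_integral_mono: "(\<And>x. \<phi> x \<le> \<psi> x) \<Longrightarrow> outer_integral \<phi> \<le> outer_integral \<psi>"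
  unfolding outer_integral_def
  by (rule INF_superset_mono) (unfold majorants_def, blast intro: order_trans, rule order_refl)

lemma outer_integral_continuous_le:
  assumes "continuous_on UNIV f" "\<And>x. 0 \<le> f x"
  shows "outer_integral (\<lambda>x. ennreal (f x)) \<le> ennreal (\<Lambda> f)"
proof -
  define g where "g n = (if n = 0 then f else (\<lambda>x. 0))" for n :: nat
  have "(\<Sum>n. ennreal (g n x)) = ennreal (f x)" for x
    by (subst suminf_finite[of "{0}"]) (auto simp: g_def)
  moreover have "(\<Sum>n. ennreal (\<Lambda> (g n))) = ennreal (\<Lambda> f)"
    by (subst suminf_finite[of "{0}"]) (auto simp: g_def zero)
  moreover have "continuous_on UNIV (g n)" "0 \<le> g n x" for n x
    using assms by (auto simp: g_def)
  ultimately show ?thesis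
    using outer_integral_le[of g "\<lambda>x. ennreal (f x)"] by (auto simp: majorants_def)
qed

lemma outer_integral_zero: "outer_integral (\<lambda>x. 0) = 0"
  using outer_integral_continuous_le[of "\<lambda>x. 0"] by (simp add: zero)

text \<open>Choose nearly optimal majorants of the \<open>i\<close>-th function with an error \<open>e / 2 ^ Suc i\<close>, and
  enumerate the resulting double family as a single sequence.\<close>

lemma outer_integral_suminf_le:
  "outer_integral (\<lambda>x. \<Sum>i. \<phi> i x) \<le> (\<Sum>i. outer_integral (\<phi> i))"
proof (rule ennreal_le_epsilon)
  fix e :: real assume e: "0 < e" and fin: "(\<Sum>i. outer_integral (\<phi> i)) < top"
  have "\<exists>f\<in>majorants (\<phi> i).
      (\<Sum>n. ennreal (\<Lambda> (f n))) < outer_integral (\<phi> i) + ennreal (e * (1/2) ^ Suc i)" for i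
    by (rule INF_approx_ennreal)
      (use e ennreal_suminf_lessD[OF fin, of i] in \<open>simp_all add: outer_integral_def[symmetric]\<close>)
  then obtain f where f: "\<And>i. f i \<in> majorants (\<phi> i)"
    and f_le: "\<And>i. (\<Sum>n. ennreal (\<Lambda> (f i n))) < outer_integral (\<phi> i) + ennreal (e * (1/2) ^ Suc i)"
    by metis
  define g where "g m = (case prod_decode m of (i, n) \<Rightarrow> f i n)" for m
  have "(\<Sum>m. ennreal (g m x)) = (\<Sum>i. \<Sum>n. ennreal (f i n x))" for x
    unfolding g_def
    using suminf_ennreal_2dimen[of "\<lambda>i. \<Sum>n. ennreal (f i n x)" "\<lambda>(i, n). ennreal (f i n x)"]
    by (simp add: split_beta)
  then have "(\<Sum>i. \<phi> i x) \<le> (\<Sum>m. ennreal (g m x))" for x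
    using f by (auto intro!: suminf_le simp: majorants_def)
  then have "g \<in> majorants (\<lambda>x. \<Sum>i. \<phi> i x)"
    using f by (auto simp: majorants_def g_def split: prod.split)
  then have "outer_integral (\<lambda>x. \<Sum>i. \<phi> i x) \<le> (\<Sum>m. ennreal (\<Lambda> (g m)))"
    by (rule outer_integral_le)
  also have "\<dots> = (\<Sum>i. \<Sum>n. ennreal (\<Lambda> (f i n)))"
    unfolding g_def
    using suminf_ennreal_2dimen[of "\<lambda>i. \<Sum>n. ennreal (\<Lambda> (f i n))" "\<lambda>(i, n). ennreal (\<Lambda> (f i n))"]
    by (simp add: split_beta)
  also have "\<dots> \<le> (\<Sum>i. outer_integral (\<phi> i) + ennreal (e * (1/2) ^ Suc i))"
    by (intro suminf_le summableI less_imp_le[OF f_le])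
  also have "\<dots> = (\<Sum>i. outer_integral (\<phi> i)) + (\<Sum>i. ennreal e * ennreal ((1/2) ^ Suc i))"
    using e by (subst suminf_add[symmetric])
      (auto simp del: ennreal_suminf_cmult simp add: ennreal_mult[symmetric])
  also have "\<dots> = (\<Sum>i. outer_integral (\<phi> i)) + e"
    unfolding ennreal_suminf_cmult
    by (subst suminf_ennreal_eq[OF zero_le_power power_half_series]) auto
  finally show "outer_integral (\<lambda>x. \<Sum>i. \<phi> i x) \<le> (\<Sum>i. outer_integral (\<phi> i)) + ennreal e" .
qed

lemma outer_integral_le_suminf:
  "(\<And>x. \<phi> x \<le> (\<Sum>i. \<psi> i x)) \<Longrightarrow> outer_integral \<phi> \<le> (\<Sum>i. outer_integral (\<psi> i))"
  by (rule order_trans[OF outer_integral_mono outer_integral_suminf_le])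

text \<open>This is the Caratheodory condition for the set \<open>{x. 0 < h x}\<close>, stated for one continuous
  function in place of a test set. The products \<open>f x * ramp h k x\<close> increase to the part of \<open>f\<close>
  inside, and each remainder \<open>f x - f x * ramp h k x\<close> dominates the part outside. For every \<open>k\<close>
  the product and the remainder have functional values summing to \<open>\<Lambda> f\<close>.\<close>

lemma outer_integral_cut:
  fixes f h :: "'a \<Rightarrow> real"
  assumes h: "continuous_on UNIV h" "\<And>x. 0 \<le> h x"
    and f: "continuous_on UNIV f" "\<And>x. 0 \<le> f x"
  shows "outer_integral (\<lambda>x. ennreal (f x) * indicator {x. 0 < h x} x) +
    outer_integral (\<lambda>x. ennreal (f x) * indicator {x. \<not> 0 < h x} x) \<le> ennreal (\<Lambda> f)"
proof -
  let ?in = "\<lambda>x. ennreal (f x) * indicator {x. 0 < h x} x"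
  let ?out = "\<lambda>x. ennreal (f x) * indicator {x. \<not> 0 < h x} x"
  let ?g = "\<lambda>k x. f x * ramp h k x"
  have contr: "continuous_on UNIV (ramp h k)" for k
    by (rule continuous_on_ramp[OF h(1)])
  have cont: "continuous_on UNIV (?g k)" for k
    using f(1) contr by (intro continuous_intros)
  have ramp: "0 \<le> ramp h k x" "ramp h k x \<le> 1" "ramp h k x \<le> ramp h (Suc k) x" for k x
    using ramp_bounds[of h x k] h(2) by auto
  \<comment> \<open>A majorant of the part inside: the increments of the products, whose partial sums telescope.\<close>
  define d where "d k x = ?g (Suc k) x - ?g k x" for k x
  have d_nonneg: "0 \<le> d k x" for k x
    using ramp(3)[of k x] f(2)[of x] by (simp add: d_def mult_left_mono)
  have cont_d: "continuous_on UNIV (d k)" for k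
    unfolding d_def by (intro continuous_on_diff cont)
  have "(\<Sum>k. ennreal (d k x)) = ?in x" for x
  proof -
    have "(\<Sum>k<n. ennreal (d k x)) = ennreal (f x) * ennreal (ramp h n x)" for n
    proof -
      have "(\<Sum>k<n. d k x) = ?g n x"
        unfolding d_def by (subst sum_lessThan_telescope) (simp add: ramp_0)
      then show ?thesis
        using d_nonneg f(2) ramp(1) by (simp add: sum_ennreal ennreal_mult)
    qed
    then have "(\<Sum>k. ennreal (d k x)) = (SUP n. ennreal (f x) * ennreal (ramp h n x))"
      by (simp add: suminf_eq_SUP)
    also have "\<dots> = ?in x"
      by (simp add: SUP_mult_left_ennreal[symmetric] SUP_ramp[of h x] h(2))
    finally show ?thesis .
  qed
  then have "d \<in> majorants ?in"
    using cont_d d_nonneg by (simp add: majorants_def)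
  then have "outer_integral ?in \<le> (\<Sum>k. ennreal (\<Lambda> (d k)))"
    by (rule outer_integral_le)
  also have "\<dots> = (SUP n. ennreal (\<Lambda> (?g n)))"
  proof -
    have "(\<Sum>k<n. ennreal (\<Lambda> (d k))) = ennreal (\<Lambda> (?g n))" for n
    proof -
      have "(\<Sum>k<n. \<Lambda> (d k)) = (\<Sum>k<n. \<Lambda> (?g (Suc k)) - \<Lambda> (?g k))"
        unfolding d_def using diff[OF cont cont] by simp
      also have "\<dots> = \<Lambda> (?g n)"
        by (subst sum_lessThan_telescope) (simp add: ramp_0 zero)
      finally show ?thesis
        using nonneg[OF cont_d d_nonneg] by (simp add: sum_ennreal)
    qed
    then show ?thesis by (simp add: suminf_eq_SUP)
  qed
  finally have "outer_integral ?in + outer_integral ?out \<le>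
      (SUP n. ennreal (\<Lambda> (?g n))) + outer_integral ?out"
    by (rule add_right_mono)
  also have "\<dots> = (SUP n. ennreal (\<Lambda> (?g n)) + outer_integral ?out)"
    by (rule ennreal_SUP_add_left[symmetric]) simp
  also have "\<dots> \<le> ennreal (\<Lambda> f)"
  proof (rule SUP_least)
    fix n
    let ?r = "\<lambda>x. f x - ?g n x"
    have r: "continuous_on UNIV ?r" "0 \<le> ?r x" for x
      using cont[of n] f ramp(2)[of n x] mult_left_le[of "ramp h n x" "f x"]
      by (auto intro: continuous_intros)
    have "outer_integral ?out \<le> outer_integral (\<lambda>x. ennreal (?r x))"
    proof (rule outer_integral_mono)
      fix x show "?out x \<le> ennreal (?r x)"
        using h(2)[of x] by (cases "0 < h x") (simp_all add: ramp_def)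
    qed
    also have "\<dots> \<le> ennreal (\<Lambda> ?r)"
      using r by (rule outer_integral_continuous_le)
    finally have "ennreal (\<Lambda> (?g n)) + outer_integral ?out \<le> ennreal (\<Lambda> (?g n)) + ennreal (\<Lambda> ?r)"
      by (rule add_left_mono)
    also have "\<dots> = ennreal (\<Lambda> f)"
      using diff[OF f(1) cont[of n]] nonneg[OF r] nonneg[OF cont[of n]] f(2) ramp(1)
      by (simp add: ennreal_plus[symmetric] del: ennreal_plus)
    finally show "ennreal (\<Lambda> (?g n)) + outer_integral ?out \<le> ennreal (\<Lambda> f)" .
  qed
  finally show ?thesis .
qed

definition \<nu> :: "'a set \<Rightarrow> ennreal"
  where "\<nu> A = outer_integral (indicator A)"

lemma \<nu>_mono: "A \<subseteq> B \<Longrightarrow> \<nu> A \<le> \<nu> B"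
  unfolding \<nu>_def by (rule outer_integral_mono) (auto simp: indicator_def)

lemma outer_measure_space_\<nu>: "outer_measure_space (Pow UNIV) \<nu>"
  unfolding outer_measure_space_def
proof (intro conjI)
  show "positive (Pow UNIV) \<nu>"
    using outer_integral_zero by (simp add: positive_def \<nu>_def indicator_def[abs_def])
  show "increasing (Pow UNIV) \<nu>"
    by (simp add: increasing_def \<nu>_mono)
  show "countably_subadditive (Pow UNIV) \<nu>"
    unfolding countably_subadditive_def
  proof (intro allI impI)
    fix A :: "nat \<Rightarrow> 'a set" assume "disjoint_family A"
    then have "indicator (\<Union>i. A i) = (\<lambda>x. \<Sum>i. indicator (A i) x :: ennreal)"
      by (auto simp: fun_eq_iff suminf_indicator)
    then show "\<nu> (\<Union>i. A i) \<le> (\<Sum>i. \<nu> (A i))"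
      unfolding \<nu>_def using outer_integral_suminf_le[of "\<lambda>i. indicator (A i)"] by simp
  qed
qed

text \<open>Given majorants of the indicator of a test set \<open>A\<close>, cut each of them along \<open>{x. 0 < h x}\<close>:
  the inner parts cover \<open>A\<close> inside, the outer parts cover it outside, and by the cutting inequality
  no mass is gained.\<close>

lemma cozero_in_lambda_system:
  fixes h :: "'a \<Rightarrow> real"
  assumes h: "continuous_on UNIV h" "\<And>x. 0 \<le> h x"
  shows "{x. 0 < h x} \<in> lambda_system UNIV (Pow UNIV) \<nu>"
proof -
  interpret P: sigma_algebra UNIV "Pow (UNIV :: 'a set)" by (rule sigma_algebra_Pow)
  let ?U = "{x. 0 < h x}"
  have "\<nu> (?U \<inter> A) + \<nu> ((UNIV - ?U) \<inter> A) = \<nu> A" for A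
  proof (rule antisym)
    show "\<nu> (?U \<inter> A) + \<nu> ((UNIV - ?U) \<inter> A) \<le> \<nu> A"
      unfolding \<nu>_def[of A] outer_integral_def
    proof (rule INF_greatest)
      fix f assume f: "f \<in> majorants (indicator A)"
      let ?in = "\<lambda>n x. ennreal (f n x) * indicator ?U x"
      let ?out = "\<lambda>n x. ennreal (f n x) * indicator {x. \<not> 0 < h x} x"
      have "1 \<le> (\<Sum>n. ennreal (f n x))" if "x \<in> A" for x
        using majorantsD(3)[OF f, of x] that by simp
      then have "indicator (?U \<inter> A) x \<le> (\<Sum>n. ?in n x)"
        "indicator ((UNIV - ?U) \<inter> A) x \<le> (\<Sum>n. ?out n x)" for x
        by (auto simp: indicator_def)
      from this[THEN outer_integral_le_suminf]
      have "\<nu> (?U \<inter> A) \<le> (\<Sum>n. outer_integral (?in n))"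
        "\<nu> ((UNIV - ?U) \<inter> A) \<le> (\<Sum>n. outer_integral (?out n))"
        by (simp_all only: \<nu>_def)
      then have "\<nu> (?U \<inter> A) + \<nu> ((UNIV - ?U) \<inter> A) \<le>
          (\<Sum>n. outer_integral (?in n) + outer_integral (?out n))"
        by (simp add: suminf_add[symmetric] add_mono)
      also have "\<dots> \<le> (\<Sum>n. ennreal (\<Lambda> (f n)))"
        by (intro suminf_le summableI outer_integral_cut[OF h] majorantsD[OF f])
      finally show "\<nu> (?U \<inter> A) + \<nu> ((UNIV - ?U) \<inter> A) \<le> (\<Sum>n. ennreal (\<Lambda> (f n)))" .
    qed
    have "subadditive (Pow UNIV) \<nu>"
      using P.countably_subadditive_subadditive outer_measure_space_\<nu>
      by (simp only: outer_measure_space_def)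
    then have "\<nu> ((?U \<inter> A) \<union> ((UNIV - ?U) \<inter> A)) \<le> \<nu> (?U \<inter> A) + \<nu> ((UNIV - ?U) \<inter> A)"
      by (rule subadditiveD) auto
    moreover have "(?U \<inter> A) \<union> ((UNIV - ?U) \<inter> A) = A" by auto
    ultimately show "\<nu> A \<le> \<nu> (?U \<inter> A) + \<nu> ((UNIV - ?U) \<inter> A)" by simp
  qed
  then show ?thesis by (simp add: lambda_system_def)
qed

text \<open>Compactness prevents mass from being lost. If a series of nonnegative continuous functions
  is everywhere at least \<open>1\<close>, then finitely many terms already exceed \<open>1 - e\<close> uniformly, so their functional values sum
  to at least \<open>(1 - e) * \<Lambda> 1\<close>.\<close>

lemma \<nu>_UNIV:
  assumes compact: "compact (UNIV :: 'a set)"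
  shows "\<nu> UNIV = ennreal (\<Lambda> (\<lambda>x. 1))"
proof (rule antisym)
  show "\<nu> UNIV \<le> ennreal (\<Lambda> (\<lambda>x. 1))"
    unfolding \<nu>_def using outer_integral_continuous_le[of "\<lambda>x. 1"]
    by (simp add: outer_integral_mono order_trans[OF outer_integral_mono])
  show "ennreal (\<Lambda> (\<lambda>x. 1)) \<le> \<nu> UNIV"
    unfolding \<nu>_def outer_integral_def
  proof (rule INF_greatest)
    fix f assume f: "f \<in> majorants (indicator UNIV)"
    have partial: "(\<Sum>i<n. ennreal (f i x)) = ennreal (\<Sum>i<n. f i x)" for n x
      using majorantsD(2)[OF f] by (simp add: sum_ennreal)
    have bound: "(1 - e) * \<Lambda> (\<lambda>x. 1) \<le> (\<Sum>i<n. \<Lambda> (f i))"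
      if "\<And>x. 1 - e < (\<Sum>i<n. f i x)" for e n
    proof -
      have "\<Lambda> (\<lambda>x. (1 - e) * 1) \<le> \<Lambda> (\<lambda>x. \<Sum>i<n. f i x)"
        by (intro mono continuous_intros majorantsD(1)[OF f]) (use that in \<open>simp add: less_imp_le\<close>)
      then show ?thesis
        using sum[of "{..<n}" f] majorantsD(1)[OF f] scale[of "\<lambda>x. 1" "1 - e"] by simp
    qed
    have le: "ennreal ((1 - e) * \<Lambda> (\<lambda>x. 1)) \<le> (\<Sum>n. ennreal (\<Lambda> (f n)))" if e: "0 < e" "e < 1" for e
    proof -
      let ?V = "\<lambda>n. {x. 1 - e < (\<Sum>i<n. f i x)}"
      have "open (?V n)" for n
        by (intro open_Collect_less continuous_intros majorantsD(1)[OF f])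
      moreover have "UNIV \<subseteq> (\<Union>n. ?V n)"
      proof
        fix x
        have "ennreal (1 - e) < 1" using e by (simp add: ennreal_less_one_iff)
        also have "1 \<le> (SUP n. \<Sum>i<n. ennreal (f i x))"
          using majorantsD(3)[OF f, of x] by (simp add: suminf_eq_SUP)
        finally obtain n where "ennreal (1 - e) < ennreal (\<Sum>i<n. f i x)"
          by (auto simp: less_SUP_iff partial)
        then have "1 - e < (\<Sum>i<n. f i x)" using e by (simp add: ennreal_less_iff)
        then show "x \<in> (\<Union>n. ?V n)" by auto
      qed
      ultimately obtain N where N: "finite N" "UNIV \<subseteq> (\<Union>n\<in>N. ?V n)"
        using compactE_image[OF compact, of UNIV ?V] by (metis UNIV_I)
      \<comment> \<open>Inserting \<open>0\<close> supplies the nonempty set that a maximum requires.\<close>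
      define m where "m = Max (insert 0 N)"
      have "1 - e < (\<Sum>i<m. f i x)" for x
      proof -
        obtain n where n: "n \<in> N" "1 - e < (\<Sum>i<n. f i x)" using N(2) by blast
        have "n \<le> m" unfolding m_def using N(1) n(1) by simp
        then have "(\<Sum>i<n. f i x) \<le> (\<Sum>i<m. f i x)"
          using majorantsD(2)[OF f] by (intro sum_mono2) auto
        with n(2) show ?thesis by simp
      qed
      then have "ennreal ((1 - e) * \<Lambda> (\<lambda>x. 1)) \<le> ennreal (\<Sum>i<m. \<Lambda> (f i))"
        by (intro ennreal_leI bound)
      also have "\<dots> = (\<Sum>i<m. ennreal (\<Lambda> (f i)))"
        using majorantsD(4)[OF f] by (simp add: sum_ennreal)
      also have "\<dots> \<le> (\<Sum>n. ennreal (\<Lambda> (f n)))"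
        by (rule sum_le_suminf) auto
      finally show ?thesis .
    qed
    have "(\<lambda>n. ennreal ((1 - inverse (real (Suc (Suc n)))) * \<Lambda> (\<lambda>x. 1))) \<longlonglongrightarrow> ennreal ((1 - 0) * \<Lambda> (\<lambda>x. 1))"
      by (intro tendsto_intros tendsto_ennrealI LIMSEQ_Suc[OF LIMSEQ_inverse_real_of_nat])
    then have "ennreal ((1 - 0) * \<Lambda> (\<lambda>x. 1)) \<le> (\<Sum>n. ennreal (\<Lambda> (f n)))"
      by (rule LIMSEQ_le_const2) (auto intro!: le simp: inverse_less_1_iff)
    then show "ennreal (\<Lambda> (\<lambda>x. 1)) \<le> (\<Sum>n. ennreal (\<Lambda> (f n)))" by simp
  qed
qed

end

section \<open>The Riesz representation theorem\<close>

text \<open>The part of \<open>f\<close> between the heights \<open>i * e\<close> and \<open>(i + 1) * e\<close>; its values lie in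
  \<open>{0..e}\<close> when \<open>0 \<le> e\<close>.\<close>

definition slice :: "('a \<Rightarrow> real) \<Rightarrow> real \<Rightarrow> nat \<Rightarrow> 'a \<Rightarrow> real"
  where "slice f e i x = min (f x) (real (Suc i) * e) - min (f x) (real i * e)"

lemma sum_slices:
  assumes "\<And>x. 0 \<le> f x" "\<And>x. f x \<le> real N * e"
  shows "(\<Sum>i<N. slice f e i x) = f x"
  unfolding slice_def by (subst sum_lessThan_telescope) (use assms in \<open>simp add: min_def antisym\<close>)

lemma slice_bounds:
  assumes "0 \<le> e"
  shows "0 \<le> slice f e i x" "slice f e i x \<le> e * indicator {x. real i * e < f x} x"
    "e * indicator {x. real (Suc i) * e < f x} x \<le> slice f e i x"
  using assms by (auto simp: slice_def min_def indicator_def algebra_simps)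

lemma continuous_slice:
  fixes f :: "'a::topological_space \<Rightarrow> real"
  shows "continuous_on UNIV f \<Longrightarrow> continuous_on UNIV (slice f e i)"
  unfolding slice_def by (intro continuous_intros)

locale normalized_positive_functional = positive_functional \<Lambda>
  for \<Lambda> :: "('a::topological_space \<Rightarrow> real) \<Rightarrow> real" +
  assumes compact: "compact (UNIV :: 'a set)"
    and metrizable: "metrizable_space (euclidean :: 'a topology)"
    and normalized: "\<Lambda> (\<lambda>x. 1) = 1"
begin

definition representing :: "'a measure"
  where "representing = measure_of UNIV (sets borel) \<nu>"

lemma sets_representing [simp, measurable_cong]: "sets representing = sets borel"
  and space_representing [simp]: "space representing = UNIV"
  using sets.sigma_sets_eq[of "borel :: 'a measure"] by (simp_all add: representing_def)

lemma emeasure_representing: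
  assumes A: "A \<in> sets borel"
  shows "emeasure representing A = \<nu> A"
proof -
  interpret P: sigma_algebra UNIV "Pow (UNIV :: 'a set)" by (rule sigma_algebra_Pow)
  let ?L = "lambda_system UNIV (Pow UNIV) \<nu>"
  have L: "measure_space UNIV ?L \<nu>"
    by (rule P.caratheodory_lemma[OF outer_measure_space_\<nu>])
  then have "sigma_algebra UNIV ?L" by (simp add: measure_space_def)
  moreover have "{U. open U} \<subseteq> ?L"
  proof safe
    fix U :: "'a set" assume "open U"
    then obtain h :: "'a \<Rightarrow> real" where "continuous_on UNIV h" "\<And>x. 0 \<le> h x" "U = {x. 0 < h x}"
      using metrizable_open_eq_cozero[OF metrizable] by metis
    then show "U \<in> ?L" using cozero_in_lambda_system[of h] by simp
  qed
  ultimately have "sets (borel :: 'a measure) \<subseteq> ?L"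
    unfolding borel_def by (simp add: sigma_algebra.sigma_sets_subset)
  then have "measure_space UNIV (sets borel) \<nu>"
    using measure_down[OF L] sets.sigma_algebra_axioms[of "borel :: 'a measure"] by simp
  then show ?thesis
    using emeasure_measure_of[OF representing_def, of A] A
    by (simp add: measure_space_def)
qed

lemma prob_space_representing: "prob_space representing"
  by (rule prob_spaceI) (simp add: emeasure_representing \<nu>_UNIV[OF compact] normalized)

text \<open>Both sides are compared with \<open>e\<close> times the measure of the superlevel set at height
  \<open>(i + 1) * e\<close>: the slice just above that height is at most \<open>e\<close> on this set and vanishes off it,
  while the slice just below equals \<open>e\<close> on it. The shift of the index is what makes the two
  estimates meet.\<close>

lemma nn_integral_slice_le:
  assumes f: "continuous_on UNIV f" and e: "0 \<le> e"
  shows "(\<integral>\<^sup>+x. ennreal (slice f e (Suc i) x) \<partial>representing) \<le> ennreal (\<Lambda> (slice f e i))"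
proof -
  let ?U = "{x. real (Suc i) * e < f x}"
  have U: "open ?U" by (intro open_Collect_less continuous_intros f)
  have "(\<integral>\<^sup>+x. ennreal (slice f e (Suc i) x) \<partial>representing) \<le>
      (\<integral>\<^sup>+x. ennreal e * indicator ?U x \<partial>representing)"
  proof (rule nn_integral_mono)
    fix x
    show "ennreal (slice f e (Suc i) x) \<le> ennreal e * indicator ?U x"
      using slice_bounds(2)[OF e, of f "Suc i" x]
      by (cases "x \<in> ?U") (simp_all add: ennreal_leI ennreal_neg)
  qed
  also have "\<dots> = ennreal e * outer_integral (indicator ?U)"
    using U by (simp add: nn_integral_cmult_indicator emeasure_representing \<nu>_def)
  also have "\<dots> \<le> ennreal (\<Lambda> (slice f e i))"
  proof (cases "e = 0")
    case False
    then have pos: "0 < e" using e by simp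
    let ?g = "\<lambda>x. inverse e * slice f e i x"
    have g: "continuous_on UNIV ?g" by (intro continuous_intros continuous_slice f)
    have "outer_integral (indicator ?U) \<le> outer_integral (\<lambda>x. ennreal (?g x))"
    proof (rule outer_integral_mono)
      fix x
      show "indicator ?U x \<le> ennreal (?g x)"
        using slice_bounds(3)[OF e, of i f x] pos
        by (auto simp: indicator_def field_simps split: if_splits)
    qed
    also have "\<dots> \<le> ennreal (\<Lambda> ?g)"
      using g slice_bounds(1)[OF e, of f i] e by (intro outer_integral_continuous_le) auto
    also have "\<Lambda> ?g = inverse e * \<Lambda> (slice f e i)"
      by (rule scale[OF continuous_slice[OF f]])
    finally have "ennreal e * outer_integral (indicator ?U) \<le>
        ennreal e * ennreal (inverse e * \<Lambda> (slice f e i))"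
      by (rule mult_left_mono) simp
    also have "\<dots> = ennreal (\<Lambda> (slice f e i))"
      using pos nonneg[OF continuous_slice[OF f] slice_bounds(1)[OF e]]
      by (simp add: ennreal_mult[symmetric] mult.assoc[symmetric])
    finally show ?thesis .
  qed simp
  finally show ?thesis .
qed

text \<open>Summing the slice estimate over all slices of height \<open>e\<close> gives the claim up to the lowest
  slice, which nothing below dominates; it contributes at most \<open>e\<close> because the total mass is
  \<open>1\<close>.\<close>

lemma nn_integral_representing_le:
  assumes f: "continuous_on UNIV f" and bounds: "\<And>x. 0 \<le> f x" "\<And>x. f x \<le> 1"
  shows "(\<integral>\<^sup>+x. ennreal (f x) \<partial>representing) \<le> ennreal (\<Lambda> f)"
proof (rule ennreal_le_epsilon)
  interpret prob_space representing by (rule prob_space_representing)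
  fix \<delta> :: real assume "0 < \<delta>"
  then obtain N where N: "inverse (real (Suc N)) < \<delta>" using reals_Archimedean by blast
  define e where "e = inverse (real (Suc N))"
  have e: "0 \<le> e" by (simp add: e_def)
  let ?s = "slice f e"
  have sum_s: "(\<Sum>i<Suc N. ?s i x) = f x" for x
    using bounds by (intro sum_slices) (auto simp: e_def)
  have [measurable]: "?s i \<in> borel_measurable borel" for i
    by (intro borel_measurable_continuous_onI continuous_slice f)
  note s_nonneg = slice_bounds(1)[OF e, of f]
  have "ennreal (f x) = (\<Sum>i<Suc N. ennreal (?s i x))" for x
    using s_nonneg by (simp add: sum_ennreal sum_s[symmetric] del: sum.lessThan_Suc)
  then have "(\<integral>\<^sup>+x. ennreal (f x) \<partial>representing) =
      (\<Sum>i<Suc N. \<integral>\<^sup>+x. ennreal (?s i x) \<partial>representing)"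
    by (simp add: nn_integral_sum del: sum.lessThan_Suc)
  also have "\<dots> = (\<integral>\<^sup>+x. ennreal (?s 0 x) \<partial>representing) +
      (\<Sum>i<N. \<integral>\<^sup>+x. ennreal (?s (Suc i) x) \<partial>representing)"
    by (rule sum.lessThan_Suc_shift)
  also have "\<dots> \<le> ennreal e + (\<Sum>i<N. ennreal (\<Lambda> (?s i)))"
  proof (intro add_mono sum_mono nn_integral_slice_le f e)
    have "ennreal (?s 0 x) \<le> ennreal e" for x
      using slice_bounds(2)[OF e, of f 0 x] e
      by (intro ennreal_leI) (cases "0 < f x"; simp)
    then have "(\<integral>\<^sup>+x. ennreal (?s 0 x) \<partial>representing) \<le> (\<integral>\<^sup>+x. ennreal e \<partial>representing)"
      by (rule nn_integral_mono)
    then show "(\<integral>\<^sup>+x. ennreal (?s 0 x) \<partial>representing) \<le> ennreal e"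
      using emeasure_space_1 by simp
  qed
  also have "(\<Sum>i<N. ennreal (\<Lambda> (?s i))) \<le> (\<Sum>i<Suc N. ennreal (\<Lambda> (?s i)))"
    by simp
  also have "\<dots> = ennreal (\<Lambda> (\<lambda>x. \<Sum>i<Suc N. ?s i x))"
    using nonneg[OF continuous_slice[OF f] s_nonneg] sum[of "{..<Suc N}" ?s] continuous_slice[OF f]
    by (simp add: sum_ennreal del: sum.lessThan_Suc)
  also have "(\<lambda>x. \<Sum>i<Suc N. ?s i x) = f"
    using sum_s by (simp add: fun_eq_iff)
  also have "ennreal e + ennreal (\<Lambda> f) \<le> ennreal (\<Lambda> f) + ennreal \<delta>"
    using N by (simp add: e_def add.commute add_left_mono ennreal_leI)
  finally show "(\<integral>\<^sup>+x. ennreal (f x) \<partial>representing) \<le> ennreal (\<Lambda> f) + ennreal \<delta>"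
    by (simp add: add_mono)
qed

text \<open>The inequality \<open>\<integral> g \<le> \<Lambda> g\<close> is an equality once it holds for \<open>f\<close> and \<open>- f\<close>; the measure and the
  functional both have total mass \<open>1\<close>, so adding constants to reach the unit interval is
  harmless.\<close>

lemma integral_representing:
  assumes f: "continuous_on UNIV f"
  shows "(\<integral>x. f x \<partial>representing) = \<Lambda> f"
proof -
  interpret prob_space representing by (rule prob_space_representing)
  have "bounded (range f)"
    using compact_continuous_image[OF f compact] by (rule compact_imp_bounded)
  then obtain B where B: "0 < B" "\<And>x. \<bar>f x\<bar> \<le> B" by (auto simp: bounded_pos)
  have meas: "g \<in> borel_measurable representing" if "continuous_on UNIV g" for g :: "'a \<Rightarrow> real"
    using borel_measurable_continuous_onI[OF that] by simp
  have le: "(\<integral>x. g x \<partial>representing) \<le> \<Lambda> g"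
    if g: "continuous_on UNIV g" and bounds: "\<And>x. 0 \<le> g x" "\<And>x. g x \<le> 1" for g
    using nn_integral_representing_le[OF g bounds] nonneg[OF g bounds(1)] bounds(1) meas[OF g]
    by (simp add: integral_eq_nn_integral enn2real_leI)
  have prob_one: "prob UNIV = 1" using prob_space by simp
  have int: "integrable representing f"
    using B(2) meas[OF f] by (intro integrable_const_bound[of _ B]) auto
  \<comment> \<open>Scaling by \<open>c\<close> and shifting moves the function into the unit interval; both signs of
      \<open>c\<close> are used.\<close>
  have scaled: "c * (\<integral>x. f x \<partial>representing) \<le> c * \<Lambda> f" if c: "\<bar>c\<bar> = 1 / (2 * B)" for c
  proof -
    have "\<bar>c * f x\<bar> \<le> 1 / (2 * B) * B" for x
      unfolding abs_mult c using B by (intro mult_left_mono) auto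
    then have half: "\<bar>c * f x\<bar> \<le> 1 / 2" for x using B(1) by simp
    have lower: "0 \<le> 1 / 2 + c * f x" and upper: "1 / 2 + c * f x \<le> 1" for x
      using half[of x] by linarith+
    have "(\<integral>x. 1 / 2 + c * f x \<partial>representing) \<le> \<Lambda> (\<lambda>x. 1 / 2 + c * f x)"
      by (intro le continuous_intros f lower upper)
    moreover have "(\<integral>x. 1 / 2 + c * f x \<partial>representing) = 1 / 2 + c * (\<integral>x. f x \<partial>representing)"
      using int prob_one by (subst Bochner_Integration.integral_add) auto
    moreover have "\<Lambda> (\<lambda>x. 1 / 2 + c * f x) = 1 / 2 + c * \<Lambda> f"
      using add[of "\<lambda>x. 1 / 2 * 1" "\<lambda>x. c * f x"] scale[of "\<lambda>x. 1" "1 / 2"] scale[OF f, of c]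
        normalized f
      by (simp add: continuous_intros)
    ultimately show ?thesis by simp
  qed
  from scaled[of "1 / (2 * B)"] scaled[of "- (1 / (2 * B))"] show ?thesis
    using B(1) by (simp add: divide_le_cancel)
qed

end

text \<open>On a compact space every continuous function is bounded, so a functional on the bounded
  continuous functions is the same thing as a functional on all continuous ones.\<close>

lemma Riesz_representation:
  fixes L :: "('a::topological_space \<Rightarrow>\<^sub>C real) \<Rightarrow> real"
  assumes compact: "compact (UNIV :: 'a set)"
    and metr: "metrizable_space (euclidean :: 'a topology)"
    and lin: "linear L"
    and nonneg: "\<And>f. (\<And>x. 0 \<le> apply_bcontfun f x) \<Longrightarrow> 0 \<le> L f"
    and one: "L (const_bcontfun 1) = 1"
  obtains \<mu> where "sets \<mu> = sets borel" "prob_space \<mu>"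
    "\<And>f. (\<integral>x. apply_bcontfun f x \<partial>\<mu>) = L f"
proof -
  define \<Lambda> where "\<Lambda> f = L (Bcontfun f)" for f :: "'a \<Rightarrow> real"
  have bcontfun: "f \<in> bcontfun" if "continuous_on UNIV f" for f :: "'a \<Rightarrow> real"
    using compact_continuous_image[OF that compact] that
    by (simp add: bcontfun_def compact_imp_bounded)
  have rep_Bcontfun: "apply_bcontfun (Bcontfun f) = f" if "continuous_on UNIV f" for f :: "'a \<Rightarrow> real"
    by (rule Bcontfun_inverse[OF bcontfun[OF that]])
  interpret normalized_positive_functional \<Lambda>
  proof
    show "compact (UNIV :: 'a set)" "metrizable_space (euclidean :: 'a topology)" by fact+
    show "\<Lambda> (\<lambda>x. 1) = 1"
      unfolding \<Lambda>_def using one by (simp add: const_bcontfun_def)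
    fix f g :: "'a \<Rightarrow> real" and c :: real
    assume f: "continuous_on UNIV f"
    have "Bcontfun (\<lambda>x. c * f x) = c *\<^sub>R Bcontfun f"
      by (rule bcontfun_eqI) (simp add: rep_Bcontfun f continuous_intros)
    then show "\<Lambda> (\<lambda>x. c * f x) = c * \<Lambda> f"
      unfolding \<Lambda>_def by (simp add: linear_scale[OF lin])
    show "0 \<le> \<Lambda> f" if "\<And>x. 0 \<le> f x"
      unfolding \<Lambda>_def by (rule nonneg) (simp add: rep_Bcontfun f that)
    assume g: "continuous_on UNIV g"
    have "Bcontfun (\<lambda>x. f x + g x) = Bcontfun f + Bcontfun g"
      by (rule bcontfun_eqI) (simp add: rep_Bcontfun f g continuous_intros)
    then show "\<Lambda> (\<lambda>x. f x + g x) = \<Lambda> f + \<Lambda> g"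
      unfolding \<Lambda>_def by (simp add: linear_add[OF lin])
  qed
  show thesis
  proof
    show "sets representing = sets borel" by (rule sets_representing)
    show "prob_space representing" by (rule prob_space_representing)
    fix f :: "'a \<Rightarrow>\<^sub>C real"
    have "(\<integral>x. apply_bcontfun f x \<partial>representing) = \<Lambda> (apply_bcontfun f)"
      by (rule integral_representing) simp
    then show "(\<integral>x. apply_bcontfun f x \<partial>representing) = L f"
      by (simp add: \<Lambda>_def apply_bcontfun_inverse)
  qed
qed

text \<open>Integrals of ramps determine the measure of every open set by monotone convergence, and the
  open sets form a generator of the Borel sets that is closed under intersection.\<close>

lemma borel_measure_eqI:
  fixes M N :: "'a::topological_space measure"
  assumes metr: "metrizable_space (euclidean :: 'a topology)"
    and M: "sets M = sets borel" "prob_space M"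
    and N: "sets N = sets borel" "prob_space N"
    and eq: "\<And>f :: 'a \<Rightarrow>\<^sub>C real. (\<integral>x. apply_bcontfun f x \<partial>M) = (\<integral>x. apply_bcontfun f x \<partial>N)"
  shows "M = N"
proof (rule measure_eqI_generator_eq[where E = "{U. open U}" and A = "\<lambda>_. UNIV" and \<Omega> = UNIV])
  show "Int_stable {U :: 'a set. open U}" by (auto simp: Int_stable_def)
  show "sets M = sigma_sets UNIV {U. open U}" "sets N = sigma_sets UNIV {U. open U}"
    using M N by (simp_all add: borel_def)
  show "emeasure M UNIV \<noteq> \<infinity>"
    using finite_measure.emeasure_finite[OF prob_space.finite_measure[OF M(2)]] by simp
  fix U :: "'a set" assume "U \<in> {U. open U}"
  then obtain h :: "'a \<Rightarrow> real" where h: "continuous_on UNIV h" "\<And>x. 0 \<le> h x" "U = {x. 0 < h x}"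
    using metrizable_open_eq_cozero[OF metr] by (metis mem_Collect_eq)
  have em: "emeasure P U = (SUP k. ennreal (\<integral>x. ramp h k x \<partial>P))"
    if P: "sets P = sets borel" "prob_space P" for P
  proof -
    interpret prob_space P by fact
    have meas: "ramp h k \<in> borel_measurable P" for k
      using borel_measurable_continuous_onI[OF continuous_on_ramp[OF h(1)]] P(1)
      by (simp cong: measurable_cong_sets)
    have "U \<in> sets P" using \<open>U \<in> {U. open U}\<close> P(1) by simp
    then have "emeasure P U = (\<integral>\<^sup>+x. (SUP k. ennreal (ramp h k x)) \<partial>P)"
      using SUP_ramp[of h] h by simp
    also have "\<dots> = (SUP k. \<integral>\<^sup>+x. ennreal (ramp h k x) \<partial>P)"
    proof (rule nn_integral_monotone_convergence_SUP)
      show "incseq (\<lambda>k x. ennreal (ramp h k x))"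
        by (rule incseq_SucI) (use ramp_bounds(3)[of h] h(2) in \<open>auto simp: le_fun_def intro: ennreal_leI\<close>)
    qed (use meas in measurable)
    also have "\<dots> = (SUP k. ennreal (\<integral>x. ramp h k x \<partial>P))"
    proof (intro SUP_cong refl nn_integral_eq_integral)
      show "integrable P (ramp h k)" for k
        by (rule integrable_const_bound[of _ 1]) (use meas ramp_bounds[of h] h(2) in auto)
    qed (use ramp_bounds(1)[of h] h(2) in auto)
    finally show ?thesis .
  qed
  have "(\<integral>x. ramp h k x \<partial>M) = (\<integral>x. ramp h k x \<partial>N)" for k
  proof -
    have "ramp h k \<in> bcontfun"
      by (rule bcontfun_normI[of _ 1]) (use continuous_on_ramp[OF h(1)] ramp_bounds[of h] h(2) in auto)
    then obtain f where "ramp h k = apply_bcontfun f" by (rule bcontfunE)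
    then show ?thesis using eq[of f] by simp
  qed
  then show "emeasure M U = emeasure N U"
    using em[OF M] em[OF N] by simp
qed auto

section \<open>Duality for measures annihilating a subspace\<close>

definition dual_value :: "('a::topological_space \<Rightarrow>\<^sub>C real) set \<Rightarrow> ('a \<Rightarrow>\<^sub>C real) \<Rightarrow> real"
  where "dual_value W \<phi> = Inf {c. \<exists>w\<in>W. \<forall>x. apply_bcontfun \<phi> x \<le> apply_bcontfun w x + c}"

text \<open>If \<open>w + c\<close> dominated \<open>\<phi>\<close> with \<open>c < - norm \<phi>\<close>, then \<open>w\<close> would be bounded below by a positive
  constant, and a multiple of it would be at least \<open>1\<close> everywhere. So the infimum that defines
  the dual value is finite.\<close>

lemma dual_value_lower_bound:
  fixes W :: "('a::topological_space \<Rightarrow>\<^sub>C real) set"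
  assumes W: "subspace W" and proper: "\<And>w. w \<in> W \<Longrightarrow> \<exists>x. apply_bcontfun w x < 1"
    and w: "w \<in> W" "\<And>x. apply_bcontfun \<phi> x \<le> apply_bcontfun w x + c"
  shows "- norm \<phi> \<le> c"
proof (rule ccontr)
  assume "\<not> - norm \<phi> \<le> c"
  then have pos: "0 < - norm \<phi> - c" by simp
  obtain x where x: "apply_bcontfun (inverse (- norm \<phi> - c) *\<^sub>R w) x < 1"
    using proper[OF subspace_scale[OF W w(1)]] by blast
  have "- norm \<phi> - c \<le> apply_bcontfun w x"
    using w(2)[of x] norm_bounded[of \<phi> x] by (simp add: abs_le_iff)
  then show False using x pos by (simp add: field_simps)
qed

lemma dual_value_le:
  assumes "subspace W" "\<And>w. w \<in> W \<Longrightarrow> \<exists>x. apply_bcontfun w x < 1"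
    and "w \<in> W" "\<And>x. apply_bcontfun \<phi> x \<le> apply_bcontfun w x + c"
  shows "dual_value W \<phi> \<le> c"
  unfolding dual_value_def
  by (rule cInf_lower) (use assms dual_value_lower_bound[OF assms(1,2)] in \<open>auto intro!: bdd_belowI[of _ "- norm \<phi>"]\<close>)

lemma dual_value_nonempty:
  fixes W :: "('a::topological_space \<Rightarrow>\<^sub>C real) set"
  assumes "subspace W"
  shows "{c. \<exists>w\<in>W. \<forall>x. apply_bcontfun \<phi> x \<le> apply_bcontfun w x + c} \<noteq> {}"
proof -
  have "apply_bcontfun \<phi> x \<le> apply_bcontfun 0 x + norm \<phi>" for x
    using norm_bounded[of \<phi> x] by simp
  then show ?thesis using subspace_0[OF assms] by blast
qed

lemma sublinear_dual_value:
  assumes W: "subspace W" and proper: "\<And>w. w \<in> W \<Longrightarrow> \<exists>x. apply_bcontfun w x < 1"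
  shows "sublinear (dual_value W)"
  unfolding sublinear_def
proof (intro conjI allI impI)
  let ?F = "\<lambda>\<phi>. {c. \<exists>w\<in>W. \<forall>x. apply_bcontfun \<phi> x \<le> apply_bcontfun w x + c}"
  note le = dual_value_le[OF W proper] and ne = dual_value_nonempty[OF W]
  fix \<phi> \<psi>
  have *: "dual_value W (\<phi> + \<psi>) \<le> b + c" if b: "b \<in> ?F \<phi>" and c: "c \<in> ?F \<psi>" for b c
  proof -
    obtain v where v: "v \<in> W" "\<And>x. apply_bcontfun \<phi> x \<le> apply_bcontfun v x + b"
      using b by blast
    obtain w where w: "w \<in> W" "\<And>x. apply_bcontfun \<psi> x \<le> apply_bcontfun w x + c"
      using c by blast
    show ?thesis
    proof (rule le)
      show "v + w \<in> W" by (rule subspace_add[OF W v(1) w(1)])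
      show "apply_bcontfun (\<phi> + \<psi>) x \<le> apply_bcontfun (v + w) x + (b + c)" for x
        using v(2)[of x] w(2)[of x] by simp
    qed
  qed
  have "dual_value W (\<phi> + \<psi>) - c \<le> dual_value W \<phi>" if "c \<in> ?F \<psi>" for c
    unfolding dual_value_def[of W \<phi>] using *[OF _ that]
    by (intro cInf_greatest[OF ne]) (simp add: algebra_simps)
  then have "dual_value W (\<phi> + \<psi>) - dual_value W \<phi> \<le> dual_value W \<psi>"
    unfolding dual_value_def[of W \<psi>] by (intro cInf_greatest[OF ne]) (simp add: algebra_simps)
  then show "dual_value W (\<phi> + \<psi>) \<le> dual_value W \<phi> + dual_value W \<psi>" by simp
next
  fix \<phi> and r :: real assume r: "0 < r"
  have "dual_value W (r *\<^sub>R \<phi>) / r \<le> dual_value W \<phi>"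
    unfolding dual_value_def[of W \<phi>]
  proof (rule cInf_greatest[OF dual_value_nonempty[OF W]])
    fix c assume "c \<in> {c. \<exists>w\<in>W. \<forall>x. apply_bcontfun \<phi> x \<le> apply_bcontfun w x + c}"
    then obtain w where w: "w \<in> W" "\<And>x. apply_bcontfun \<phi> x \<le> apply_bcontfun w x + c" by blast
    have "dual_value W (r *\<^sub>R \<phi>) \<le> r * c"
    proof (rule dual_value_le[OF W proper])
      show "r *\<^sub>R w \<in> W" by (rule subspace_scale[OF W w(1)])
      show "apply_bcontfun (r *\<^sub>R \<phi>) x \<le> apply_bcontfun (r *\<^sub>R w) x + r * c" for x
        using mult_left_mono[OF w(2)[of x], of r] r by (simp add: distrib_left)
    qed
    then show "dual_value W (r *\<^sub>R \<phi>) / r \<le> c" using r by (simp add: field_simps)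
  qed
  then show "dual_value W (r *\<^sub>R \<phi>) \<le> r * dual_value W \<phi>" using r by (simp add: field_simps)
qed

lemma integrable_bcontfun:
  fixes f :: "'a::topological_space \<Rightarrow>\<^sub>C real"
  assumes "sets \<mu> = sets borel" "prob_space \<mu>"
  shows "integrable \<mu> (apply_bcontfun f)"
proof -
  interpret prob_space \<mu> by fact
  have "apply_bcontfun f \<in> borel_measurable \<mu>"
    using borel_measurable_continuous_onI[of "apply_bcontfun f"] assms(1)
    by (simp cong: measurable_cong_sets)
  then show ?thesis
    using norm_bounded[of f] by (intro integrable_const_bound[of _ "norm f"]) auto
qed

text \<open>Integrating the constraint \<open>\<phi> \<le> w + c\<close> gives one inequality. For the other there are two
  cases. If some \<open>w \<in> W\<close> is at least \<open>1\<close> everywhere, adding large multiples of it makes every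
  constant \<open>c\<close> admissible, and the infimum is \<open>-\<infinity>\<close>. Otherwise \<open>dual_value W\<close> is a real-valued
  sublinear functional, and a linear functional below it that agrees with it at \<open>\<phi>\<close> is exactly
  integration against a maximizing measure.\<close>

theorem probability_duality:
  fixes W :: "('a::topological_space \<Rightarrow>\<^sub>C real) set"
  assumes compact: "compact (UNIV :: 'a set)"
    and metr: "metrizable_space (euclidean :: 'a topology)"
    and W: "subspace W"
  shows "(SUP \<mu>\<in>{\<mu>. sets \<mu> = sets borel \<and> prob_space \<mu> \<and>
        (\<forall>w\<in>W. (\<integral>x. apply_bcontfun w x \<partial>\<mu>) = 0)}. ereal (\<integral>x. apply_bcontfun \<phi> x \<partial>\<mu>)) =
    (INF c\<in>{c. \<exists>w\<in>W. \<forall>x. apply_bcontfun \<phi> x \<le> apply_bcontfun w x + c}. ereal c)"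
    (is "(SUP \<mu>\<in>?M. ereal (?I \<mu> \<phi>)) = (INF c\<in>?F. ereal c)")
proof (rule antisym)
  have weak: "?I \<mu> \<psi> \<le> c"
    if \<mu>: "\<mu> \<in> ?M" and w: "w \<in> W" "\<And>x. apply_bcontfun \<psi> x \<le> apply_bcontfun w x + c"
    for \<mu> w c and \<psi> :: "'a \<Rightarrow>\<^sub>C real"
  proof -
    interpret prob_space \<mu> using \<mu> by simp
    have int: "integrable \<mu> (apply_bcontfun f)" for f :: "'a \<Rightarrow>\<^sub>C real"
      using \<mu> by (intro integrable_bcontfun) auto
    have "?I \<mu> \<psi> \<le> (\<integral>x. apply_bcontfun w x + c \<partial>\<mu>)"
      using int w(2) by (intro integral_mono) auto
    also have "\<dots> = c" using int \<mu> w(1) prob_space by simp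
    finally show ?thesis .
  qed
  show "(SUP \<mu>\<in>?M. ereal (?I \<mu> \<phi>)) \<le> (INF c\<in>?F. ereal c)"
    using weak by (intro SUP_least INF_greatest) auto
  show "(INF c\<in>?F. ereal c) \<le> (SUP \<mu>\<in>?M. ereal (?I \<mu> \<phi>))"
  proof (cases "\<exists>w\<in>W. \<forall>x. 1 \<le> apply_bcontfun w x")
    case True
    then obtain w where w: "w \<in> W" "\<And>x. 1 \<le> apply_bcontfun w x" by blast
    have "(INF c\<in>?F. ereal c) \<le> ereal B" for B
    proof (rule INF_lower2)
      \<comment> \<open>Since \<open>w \<ge> 1\<close>, this multiple of \<open>w\<close> makes up for the gap between \<open>B\<close> and \<open>norm \<phi>\<close>.\<close>
      let ?r = "\<bar>norm \<phi> - B\<bar>"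
      have "apply_bcontfun \<phi> x \<le> apply_bcontfun (?r *\<^sub>R w) x + B" for x
        using norm_bounded[of \<phi> x] mult_left_mono[OF w(2)[of x], of ?r] by simp
      then show "B \<in> ?F" using subspace_scale[OF W w(1)] by blast
    qed simp
    then have "(INF c\<in>?F. ereal c) = - \<infinity>" by (rule ereal_bot)
    then show ?thesis by simp
  next
    case False
    then have proper: "\<exists>x. apply_bcontfun w x < 1" if "w \<in> W" for w
      using that by (auto simp: not_le)
    note le = dual_value_le[OF W proper]
    obtain L where L: "linear L" "\<And>f. L f \<le> dual_value W f" "L \<phi> = dual_value W \<phi>"
      using Hahn_Banach_sublinear[OF sublinear_dual_value[OF W proper]] by blast
    \<comment> \<open>Positivity, normalization and vanishing on \<open>W\<close> all follow from suitable choices here.\<close>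
    have upper: "L f \<le> c" if "w \<in> W" "\<And>x. apply_bcontfun f x \<le> apply_bcontfun w x + c" for f w c
      using L(2)[of f] le[OF _ that] by (rule order_trans)
    have zero: "(0 :: 'a \<Rightarrow>\<^sub>C real) \<in> W" by (rule subspace_0[OF W])
    have neg: "L (- f) = - L f" for f by (rule linear_neg[OF L(1)])
    have nonneg: "0 \<le> L f" if "\<And>x. 0 \<le> apply_bcontfun f x" for f
      using upper[OF zero, of "- f" 0] that neg[of f] by simp
    have one: "L (const_bcontfun 1) = 1"
      using upper[OF zero, of "const_bcontfun 1" 1] upper[OF zero, of "- const_bcontfun 1" "- 1"]
        neg[of "const_bcontfun 1"] by simp
    have vanish: "L w = 0" if "w \<in> W" for w
      using upper[OF that, of w 0] upper[OF subspace_neg[OF W that], of "- w" 0] neg[of w] by simp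
    obtain \<mu> where \<mu>: "sets \<mu> = sets borel" "prob_space \<mu>" "\<And>f. ?I \<mu> f = L f"
      using Riesz_representation[OF compact metr L(1) nonneg one] by blast
    then have mem: "\<mu> \<in> ?M" using vanish by simp
    have "(INF c\<in>?F. ereal c) \<le> ereal (dual_value W \<phi>)"
    proof (rule ereal_le_epsilon2)
      fix e :: real assume "0 < e"
      then obtain c where c: "c \<in> ?F" "c < dual_value W \<phi> + e"
        using cInf_lessD[OF dual_value_nonempty[OF W], of \<phi> "dual_value W \<phi> + e"]
        by (auto simp: dual_value_def)
      then show "(INF c\<in>?F. ereal c) \<le> ereal (dual_value W \<phi>) + ereal e"
        by (intro INF_lower2[OF c(1)]) simp
    qed
    also have "\<dots> = ereal (?I \<mu> \<phi>)" by (simp add: \<mu>(3) L(3))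
    also have "\<dots> \<le> (SUP \<mu>\<in>?M. ereal (?I \<mu> \<phi>))" by (rule SUP_upper[OF mem])
    finally show ?thesis .
  qed
qed

section \<open>Invariance as a linear constraint\<close>

text \<open>
  Membership is stated pointwise because \<open>g \<circ> T\<close> need not be a bounded continuous function when
  \<open>T\<close> is not continuous; this way the set is a subspace for every map \<open>T\<close>.
\<close>

definition coboundaries :: "('a::topological_space \<Rightarrow> 'a) \<Rightarrow> ('a \<Rightarrow>\<^sub>C real) set"
  where "coboundaries T =
    {h. \<exists>g. \<forall>x. apply_bcontfun h x = apply_bcontfun g x - apply_bcontfun g (T x)}"

lemma subspace_coboundaries: "subspace (coboundaries T)"
proof (rule subspaceI)
  show "0 \<in> coboundaries T"
    by (auto simp: coboundaries_def intro!: exI[of _ 0])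
next
  fix h k assume "h \<in> coboundaries T" "k \<in> coboundaries T"
  then obtain f g where
    "\<forall>x. apply_bcontfun h x = apply_bcontfun f x - apply_bcontfun f (T x)"
    "\<forall>x. apply_bcontfun k x = apply_bcontfun g x - apply_bcontfun g (T x)"
    by (auto simp: coboundaries_def)
  then show "h + k \<in> coboundaries T"
    by (auto simp: coboundaries_def intro!: exI[of _ "f + g"])
next
  fix c :: real and h assume "h \<in> coboundaries T"
  then obtain g where "\<forall>x. apply_bcontfun h x = apply_bcontfun g x - apply_bcontfun g (T x)"
    by (auto simp: coboundaries_def)
  then show "c *\<^sub>R h \<in> coboundaries T"
    by (auto simp: coboundaries_def right_diff_distrib intro!: exI[of _ "c *\<^sub>R g"])
qed

lemma bcontfun_compose:
  fixes g :: "'a::topological_space \<Rightarrow>\<^sub>C real"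
  assumes "continuous_on UNIV T"
  obtains k where "\<And>x. apply_bcontfun k x = apply_bcontfun g (T x)"
proof -
  have "(\<lambda>x. apply_bcontfun g (T x)) \<in> bcontfun"
    using continuous_on_compose2[of UNIV "apply_bcontfun g" UNIV T] assms norm_bounded[of g]
    by (intro bcontfun_normI[of _ "norm g"]) auto
  then obtain k where "(\<lambda>x. apply_bcontfun g (T x)) = apply_bcontfun k" by (rule bcontfunE)
  then show thesis using that by metis
qed

text \<open>The integral of \<open>g - g \<circ> T\<close> is the difference of the integrals of \<open>g\<close> against the measure and
  against its image under \<open>T\<close>. Invariance is thus a family of linear constraints of the same kind
  as those in \<open>\<C>\<close>.\<close>

lemma invariant_iff_coboundaries:
  fixes T :: "'a::topological_space \<Rightarrow> 'a"
  assumes metr: "metrizable_space (euclidean :: 'a topology)"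
    and T: "continuous_on UNIV T"
    and \<mu>: "sets \<mu> = sets borel" "prob_space \<mu>"
  shows "distr \<mu> borel T = \<mu> \<longleftrightarrow> (\<forall>h\<in>coboundaries T. (\<integral>x. apply_bcontfun h x \<partial>\<mu>) = 0)"
proof -
  have meas_T: "T \<in> borel_measurable \<mu>"
    using borel_measurable_continuous_onI[OF T] \<mu>(1) by (simp cong: measurable_cong_sets)
  have distr: "(\<integral>x. apply_bcontfun g x \<partial>distr \<mu> borel T) = (\<integral>x. apply_bcontfun g (T x) \<partial>\<mu>)"
    for g :: "'a \<Rightarrow>\<^sub>C real"
    by (rule integral_distr[OF meas_T]) (rule borel_measurable_continuous_onI, simp)
  note int = integrable_bcontfun[OF \<mu>]
  have int_T: "integrable \<mu> (\<lambda>x. apply_bcontfun g (T x))" for g :: "'a \<Rightarrow>\<^sub>C real"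
  proof -
    obtain k where "\<And>x. apply_bcontfun k x = apply_bcontfun g (T x)"
      using bcontfun_compose[OF T, of g] by blast
    then have "(\<lambda>x. apply_bcontfun g (T x)) = apply_bcontfun k" by (auto simp: fun_eq_iff)
    then show ?thesis using int[of k] by simp
  qed
  have cob: "(\<integral>x. apply_bcontfun h x \<partial>\<mu>) =
      (\<integral>x. apply_bcontfun g x \<partial>\<mu>) - (\<integral>x. apply_bcontfun g x \<partial>distr \<mu> borel T)"
    if "\<forall>x. apply_bcontfun h x = apply_bcontfun g x - apply_bcontfun g (T x)"
    for g h :: "'a \<Rightarrow>\<^sub>C real"
    using that int[of g] int_T[of g] by (simp add: distr)
  show ?thesis
  proof
    assume inv: "distr \<mu> borel T = \<mu>"
    show "\<forall>h\<in>coboundaries T. (\<integral>x. apply_bcontfun h x \<partial>\<mu>) = 0"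
    proof
      fix h assume "h \<in> coboundaries T"
      then obtain g where "\<forall>x. apply_bcontfun h x = apply_bcontfun g x - apply_bcontfun g (T x)"
        by (auto simp: coboundaries_def)
      from cob[OF this] show "(\<integral>x. apply_bcontfun h x \<partial>\<mu>) = 0" by (simp add: inv)
    qed
  next
    assume zero: "\<forall>h\<in>coboundaries T. (\<integral>x. apply_bcontfun h x \<partial>\<mu>) = 0"
    show "distr \<mu> borel T = \<mu>"
    proof (rule borel_measure_eqI[OF metr])
      show "prob_space (distr \<mu> borel T)" by (rule prob_space.prob_space_distr[OF \<mu>(2) meas_T])
      fix g :: "'a \<Rightarrow>\<^sub>C real"
      obtain k where k: "\<And>x. apply_bcontfun k x = apply_bcontfun g (T x)"
        using bcontfun_compose[OF T, of g] by blast
      then have gk: "\<forall>x. apply_bcontfun (g - k) x = apply_bcontfun g x - apply_bcontfun g (T x)"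
        by simp
      then have "g - k \<in> coboundaries T" unfolding coboundaries_def by blast
      with zero have "(\<integral>x. apply_bcontfun (g - k) x \<partial>\<mu>) = 0" by (rule bspec)
      then show "(\<integral>x. apply_bcontfun g x \<partial>distr \<mu> borel T) = (\<integral>x. apply_bcontfun g x \<partial>\<mu>)"
        using cob[OF gk] by linarith
    qed (use \<mu> in auto)
  qed
qed

lemma integral_span_eq_0:
  fixes C :: "('a::topological_space \<Rightarrow>\<^sub>C real) set"
  assumes \<mu>: "sets \<mu> = sets borel" "prob_space \<mu>"
    and zero: "\<And>g. g \<in> C \<Longrightarrow> (\<integral>x. apply_bcontfun g x \<partial>\<mu>) = 0"
    and f: "f \<in> span C"
  shows "(\<integral>x. apply_bcontfun f x \<partial>\<mu>) = 0"
  using f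
proof (induction rule: span_induct_alt)
  case (step c g h)
  then show ?case using zero integrable_bcontfun[OF \<mu>] by simp
qed simp

theorem theorem1p10:
  fixes T :: "'a::topological_space \<Rightarrow> 'a"
    and \<C> :: "('a \<Rightarrow>\<^sub>C real) set"
    and \<phi> :: "'a \<Rightarrow>\<^sub>C real"
  assumes "compact (UNIV :: 'a set)"
    and "metrizable_space (euclidean :: 'a topology)"
    and "continuous_on UNIV T"
  shows "(SUP \<mu>\<in>constrained_invariant_measures T \<C>. ereal (\<integral>x. apply_bcontfun \<phi> x \<partial>\<mu>)) =
    (INF c\<in>{c :: real. \<exists>f\<in>(subspace hull \<C>). \<exists>g :: 'a \<Rightarrow>\<^sub>C real.
        \<forall>x. apply_bcontfun f x + apply_bcontfun g x - apply_bcontfun g (T x) + c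
              \<ge> apply_bcontfun \<phi> x}. ereal c)"
proof -
  \<comment> \<open>The space of constraints: its annihilator is the feasible set, its elements are the functions
      \<open>f + g - g \<circ> T\<close> of the dual problem.\<close>
  define W where "W = {f + h | f h. f \<in> span \<C> \<and> h \<in> coboundaries T}"
  have W_iff: "w \<in> W \<longleftrightarrow> (\<exists>f\<in>span \<C>. \<exists>h\<in>coboundaries T. w = f + h)" for w
    unfolding W_def by auto
  have W: "subspace W"
    unfolding W_def using subspace_sums[OF subspace_span[of \<C>] subspace_coboundaries[of T]] .
  have vanish_iff: "(\<forall>w\<in>W. (\<integral>x. apply_bcontfun w x \<partial>\<mu>) = 0) \<longleftrightarrow>
      (\<forall>g\<in>\<C>. (\<integral>x. apply_bcontfun g x \<partial>\<mu>) = 0) \<and> distr \<mu> borel T = \<mu>"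
    if \<mu>: "sets \<mu> = sets borel" "prob_space \<mu>" for \<mu>
    unfolding invariant_iff_coboundaries[OF assms(2,3) \<mu>]
  proof (intro iffI conjI ballI)
    fix g assume zero: "\<forall>w\<in>W. (\<integral>x. apply_bcontfun w x \<partial>\<mu>) = 0" and g: "g \<in> \<C>"
    have "g + 0 \<in> W"
      unfolding W_iff using span_base[OF g] subspace_0[OF subspace_coboundaries[of T]] by blast
    with zero show "(\<integral>x. apply_bcontfun g x \<partial>\<mu>) = 0" by simp
  next
    fix h assume zero: "\<forall>w\<in>W. (\<integral>x. apply_bcontfun w x \<partial>\<mu>) = 0" and h: "h \<in> coboundaries T"
    have "0 + h \<in> W"
      unfolding W_iff using span_zero[of \<C>] h by blast
    with zero show "(\<integral>x. apply_bcontfun h x \<partial>\<mu>) = 0" by simp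
  next
    fix w
    assume zero: "(\<forall>g\<in>\<C>. (\<integral>x. apply_bcontfun g x \<partial>\<mu>) = 0) \<and>
      (\<forall>h\<in>coboundaries T. (\<integral>x. apply_bcontfun h x \<partial>\<mu>) = 0)" and "w \<in> W"
    then obtain f h where w: "w = f + h" "f \<in> span \<C>" "h \<in> coboundaries T"
      unfolding W_iff by blast
    have "(\<integral>x. apply_bcontfun f x \<partial>\<mu>) = 0"
      by (rule integral_span_eq_0[OF \<mu> _ w(2)]) (use zero in simp)
    moreover have "(\<integral>x. apply_bcontfun h x \<partial>\<mu>) = 0"
      using zero w(3) by simp
    ultimately show "(\<integral>x. apply_bcontfun w x \<partial>\<mu>) = 0"
      using integrable_bcontfun[OF \<mu>] by (simp add: w(1))
  qed
  have measures: "constrained_invariant_measures T \<C> =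
      {\<mu>. sets \<mu> = sets borel \<and> prob_space \<mu> \<and> (\<forall>w\<in>W. (\<integral>x. apply_bcontfun w x \<partial>\<mu>) = 0)}"
    unfolding constrained_invariant_measures_def invariant_prob_measures_def
    by (rule set_eqI) (simp only: mem_Collect_eq conj_assoc conj_comms vanish_iff cong: conj_cong)
  have dual_values: "{c :: real. \<exists>f\<in>(subspace hull \<C>). \<exists>g :: 'a \<Rightarrow>\<^sub>C real.
        \<forall>x. apply_bcontfun f x + apply_bcontfun g x - apply_bcontfun g (T x) + c
              \<ge> apply_bcontfun \<phi> x} =
      {c. \<exists>w\<in>W. \<forall>x. apply_bcontfun \<phi> x \<le> apply_bcontfun w x + c}" (is "?A = ?B")
  proof (intro set_eqI iffI)
    fix c assume "c \<in> ?A"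
    then obtain f g where f: "f \<in> span \<C>" and
      le: "\<And>x. apply_bcontfun \<phi> x \<le>
        apply_bcontfun f x + apply_bcontfun g x - apply_bcontfun g (T x) + c"
      unfolding span_def by blast
    obtain k where k: "\<And>x. apply_bcontfun k x = apply_bcontfun g (T x)"
      using bcontfun_compose[OF assms(3), of g] by blast
    then have "\<forall>x. apply_bcontfun (g - k) x = apply_bcontfun g x - apply_bcontfun g (T x)"
      by simp
    then have "g - k \<in> coboundaries T" unfolding coboundaries_def by blast
    with f have "f + (g - k) \<in> W" unfolding W_iff by blast
    moreover have "apply_bcontfun \<phi> x \<le> apply_bcontfun (f + (g - k)) x + c" for x
      using le[of x] k[of x] by simp
    ultimately show "c \<in> ?B" by blast
  next
    fix c assume "c \<in> ?B"
    then obtain w where "w \<in> W" and le: "\<And>x. apply_bcontfun \<phi> x \<le> apply_bcontfun w x + c"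
      by blast
    then obtain f h where w: "w = f + h" and f: "f \<in> span \<C>" and h: "h \<in> coboundaries T"
      unfolding W_iff by blast
    obtain g where g: "\<And>x. apply_bcontfun h x = apply_bcontfun g x - apply_bcontfun g (T x)"
      using h unfolding coboundaries_def by blast
    have "apply_bcontfun f x + apply_bcontfun g x - apply_bcontfun g (T x) + c
        \<ge> apply_bcontfun \<phi> x" for x
      using le[of x] g[of x] by (simp add: w)
    then show "c \<in> ?A" using f unfolding span_def by blast
  qed
  show ?thesis
    unfolding measures dual_values by (rule probability_duality[OF assms(1,2) W])
qed

end
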